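(* Let $W_s^D=\{w\in\mathbb{R}^{\mathcal{J}} : \psi(w)\neq\emptyset\}$ be the absorbable region, and run the linear programming based projection algorithm from the initial set $W_{temp}=\{w\in\mathbb{R}^{\mathcal{J}} : w\ge 0\}$. Then, since $\mathcal{U}$ has finitely many vertices, the algorithm always converges (it reaches its stopping criterion $r_{max}=0$ after finitely many iterations), and its output is $W_s^D$.
   Context: Let $\mathcal{I}$ (consumers) and $\mathcal{J}$ (prosumers) be disjoint finite index sets and $\mathcal{L}$ a finite set of lines. Data: fixed demands $d_k^f\in\mathbb{R}$ and bounds $\underline{d}_k\le\overline{d}_k$ for $k\in\mathcal{I}\cup\mathcal{J}$; line flow limits $F_l$ and real line flow distribution factors $\pi_{kl}^w$ ($k\in\mathcal{J}$), $\pi_{kl}^d$ ($k\in\mathcal{I}\cup\mathcal{J}$), for $l\in\mathcal{L}$. For a renewable output vector $w=(w_k)_{k\in\mathcal{J}}$, let $\psi(w)$ be the set of $d=(d_k)_{k\in\mathcal{I}\cup\mathcal{J}}$ with $$\sum_{k\in\mathcal{J}}w_k=\sum_{k\in\mathcal{I}\cup\mathcal{J}}d_k+\sum_{k\in\mathcal{I}\cup\mathcal{J}}d_k^f,\qquad \underline{d}_k\le d_k\le\overline{d}_k\ \ (k\in\mathcal{I}\cup\mathcal{J}),$$ $$-F_l\le\sum_{k\in\mathcal{J}}\pi_{kl}^ww_k-\sum_{k\in\mathcal{I}\cup\mathcal{J}}\pi_{kl}^d(d_k^f+d_k)\le F_l\ \ (l\in\mathcal{L}).$$ Write these linear constraints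 in compact form as $\psi(w)=\{d : Ad+Bw\le c\}$ with matrices $A,B$ and vector $c$ (the equality being written as two inequalities). Let $\mathcal{U}=\{u : A^Tu=0,\ -1\le u\le 0\}$ (componentwise inequalities), and let $\mathrm{vert}(\cdot)$ denote the set of vertices (extreme points) of a polyhedron. Linear programming based projection algorithm. Input: the initial set $W_{temp}=\{w : w\ge 0\}$ (componentwise), which plays the role of a large enough polyhedron containing $W_s^D$. In each iteration: 1. Compute $\mathrm{vert}(W_{temp})$ and set $r_{max}=0$. 2. For each $w\in\mathrm{vert}(W_{temp})$, solve the linear program $\max_{u\in\mathcal{U}}u^T(c-Bw)$, obtaining an optimal solution $u^*\in\mathrm{vert}(\mathcal{U})$ and the optimal value $r^*$; set $r_{max}$ to $\max\{r_{max},r^*\}$ and let $u_{max}$ be the corresponding $u^*$. 3. If $r_{max}=0$, stop and output $W_{temp}$. Otherwise add the cutting plane $(u_{max})^TBw\ge(u_{max})^Tc$ to the description of $W_{temp}$ and return to step 1.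
   Formalization: False as stated: the run from {w≥0} may stop at an unbounded set. Proved: it always stops; if W_s^D lies in {w≥0}, its output is W_s^D exactly when bounded; from any bounded polyhedron containing W_s^D the output is W_s^D. Index sets are nonempty. *)

theory Defs
  imports "HOL-Analysis.Analysis"
begin

text \<open>
  Consumers, prosumers and lines are indexed by finite types \<open>'i\<close>, \<open>'j\<close>, \<open>'l\<close>.  The disjoint union
  of the consumers and the prosumers is the sum type \<open>'i + 'j\<close>, in which prosumer \<open>j\<close> is \<open>Inr j\<close>.
\<close>

record ('i, 'j, 'l) grid =
  dfix :: "'i + 'j \<Rightarrow> real"
  dlo :: "'i + 'j \<Rightarrow> real"
  dhi :: "'i + 'j \<Rightarrow> real"
  flim :: "'l \<Rightarrow> real"
  piw :: "'j \<Rightarrow> 'l \<Rightarrow> real"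
  pid :: "'i + 'j \<Rightarrow> 'l \<Rightarrow> real"

definition psi :: "('i::finite, 'j::finite, 'l::finite) grid \<Rightarrow> real ^ 'j \<Rightarrow> (real ^ ('i + 'j)) set" where
  "psi N w = {d.
     (\<Sum>k\<in>UNIV. w $ k) = (\<Sum>k\<in>UNIV. d $ k) + (\<Sum>k\<in>UNIV. dfix N k) \<and>
     (\<forall>k. dlo N k \<le> d $ k \<and> d $ k \<le> dhi N k) \<and>
     (\<forall>l. - flim N l \<le> (\<Sum>k\<in>UNIV. piw N k l * w $ k) - (\<Sum>k\<in>UNIV. pid N k l * (dfix N k + d $ k)) \<and>
          (\<Sum>k\<in>UNIV. piw N k l * w $ k) - (\<Sum>k\<in>UNIV. pid N k l * (dfix N k + d $ k)) \<le> flim N l)}"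

definition absorbable :: "('i::finite, 'j::finite, 'l::finite) grid \<Rightarrow> (real ^ 'j) set" where
  "absorbable N = {w. psi N w \<noteq> {}}"


subsection \<open>Compact form\<close>

text \<open>One row per inequality; the power balance contributes two.\<close>

datatype ('i, 'j, 'l) row =
  BalUp | BalLo | DemLo "'i + 'j" | DemUp "'i + 'j" | FlowLo 'l | FlowUp 'l

instance row :: (finite, finite, finite) finite
proof
  have "(UNIV :: ('a, 'b, 'c) row set) \<subseteq>
      {BalUp, BalLo} \<union> range DemLo \<union> range DemUp \<union> range FlowLo \<union> range FlowUp"
  proof
    fix r :: "('a, 'b, 'c) row"
    show "r \<in> {BalUp, BalLo} \<union> range DemLo \<union> range DemUp \<union> range FlowLo \<union> range FlowUp"
      by (cases r) simp_all
  qed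
  then show "finite (UNIV :: ('a, 'b, 'c) row set)"
    by (rule finite_subset) simp
qed

definition matA :: "('i::finite, 'j::finite, 'l::finite) grid \<Rightarrow> real ^ ('i + 'j) ^ ('i, 'j, 'l) row" where
  "matA N = (\<chi> r k. case r of
       BalUp \<Rightarrow> - 1
     | BalLo \<Rightarrow> 1
     | DemLo m \<Rightarrow> (if k = m then - 1 else 0)
     | DemUp m \<Rightarrow> (if k = m then 1 else 0)
     | FlowLo l \<Rightarrow> pid N k l
     | FlowUp l \<Rightarrow> - pid N k l)"

definition matB :: "('i::finite, 'j::finite, 'l::finite) grid \<Rightarrow> real ^ 'j ^ ('i, 'j, 'l) row" where
  "matB N = (\<chi> r k. case r of
       BalUp \<Rightarrow> 1
     | BalLo \<Rightarrow> - 1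
     | DemLo m \<Rightarrow> 0
     | DemUp m \<Rightarrow> 0
     | FlowLo l \<Rightarrow> - piw N k l
     | FlowUp l \<Rightarrow> piw N k l)"

definition vecc :: "('i::finite, 'j::finite, 'l::finite) grid \<Rightarrow> real ^ ('i, 'j, 'l) row" where
  "vecc N = (\<chi> r. case r of
       BalUp \<Rightarrow> (\<Sum>k\<in>UNIV. dfix N k)
     | BalLo \<Rightarrow> - (\<Sum>k\<in>UNIV. dfix N k)
     | DemLo m \<Rightarrow> - dlo N m
     | DemUp m \<Rightarrow> dhi N m
     | FlowLo l \<Rightarrow> flim N l - (\<Sum>k\<in>UNIV. pid N k l * dfix N k)
     | FlowUp l \<Rightarrow> flim N l + (\<Sum>k\<in>UNIV. pid N k l * dfix N k))"

lemma all_row: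
  "(\<forall>r. P r) \<longleftrightarrow> P BalUp \<and> P BalLo \<and> (\<forall>m. P (DemLo m)) \<and> (\<forall>m. P (DemUp m)) \<and>
     (\<forall>l. P (FlowLo l)) \<and> (\<forall>l. P (FlowUp l))"
  (is "_ \<longleftrightarrow> ?R")
proof
  assume ?R
  show "\<forall>r. P r"
  proof
    fix r
    show "P r"
      using \<open>?R\<close> by (cases r) simp_all
  qed
qed simp

lemma psi_compact:
  "psi N w = {d. \<forall>r. (matA N *v d + matB N *v w) $ r \<le> vecc N $ r}"
proof -
  have delta: "(\<Sum>k\<in>UNIV. (if k = m then a else 0) * d $ k) = a * d $ m"
    for a :: real and d :: "real ^ ('a + 'b)" and m
    by (simp add: if_distrib[of "\<lambda>x. x * _"] sum.delta cong: if_cong)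
  have row: "(matA N *v d + matB N *v w) $ r =
      (\<Sum>k\<in>UNIV. matA N $ r $ k * d $ k) + (\<Sum>k\<in>UNIV. matB N $ r $ k * w $ k)" for d r
    by (simp add: matrix_vector_mult_def)
  have split: "(\<Sum>k\<in>UNIV. pid N k l * (dfix N k + d $ k)) =
      (\<Sum>k\<in>UNIV. pid N k l * dfix N k) + (\<Sum>k\<in>UNIV. pid N k l * d $ k)" for d l
    by (simp add: distrib_left sum.distrib)
  have flow: "- F \<le> x - (e + y) \<and> x - (e + y) \<le> F \<longleftrightarrow> y - x \<le> F - e \<and> x - y \<le> F + e"
    for F x e y :: real
    by linarith
  have bal: "x = y + e \<longleftrightarrow> x - y \<le> e \<and> y - x \<le> - e" for x y e :: real
    by linarith
  show ?thesis
    unfolding psi_def all_row row split flow bal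
    by (rule Collect_cong) (auto simp: matA_def matB_def vecc_def delta sum_negf)
qed


subsection \<open>The projection algorithm\<close>

definition vert :: "'a::real_vector set \<Rightarrow> 'a set" where
  "vert S = {x. x extreme_point_of S}"

definition dualU :: "('i::finite, 'j::finite, 'l::finite) grid \<Rightarrow> (real ^ ('i, 'j, 'l) row) set" where
  "dualU N = {u. transpose (matA N) *v u = 0 \<and> (\<forall>r. - 1 \<le> u $ r \<and> u $ r \<le> 0)}"

definition lp_obj ::
    "('i::finite, 'j::finite, 'l::finite) grid \<Rightarrow> real ^ 'j \<Rightarrow> real ^ ('i, 'j, 'l) row \<Rightarrow> real" where
  "lp_obj N w u = u \<bullet> (vecc N - matB N *v w)"

text \<open>
  \<open>us w\<close> is the optimal vertex that the solver returns at \<open>w\<close>.  Nothing is assumed about which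
  optimal vertex it is, so \<open>us\<close> may change from one iteration to the next.
\<close>

definition lp_solutions ::
    "('i::finite, 'j::finite, 'l::finite) grid \<Rightarrow> (real ^ 'j) set \<Rightarrow>
      (real ^ 'j \<Rightarrow> real ^ ('i, 'j, 'l) row) \<Rightarrow> bool" where
  "lp_solutions N W us \<longleftrightarrow>
     (\<forall>w\<in>vert W. us w \<in> vert (dualU N) \<and> (\<forall>u\<in>dualU N. lp_obj N w u \<le> lp_obj N w (us w)))"

definition rmax ::
    "('i::finite, 'j::finite, 'l::finite) grid \<Rightarrow> (real ^ 'j) set \<Rightarrow>
      (real ^ 'j \<Rightarrow> real ^ ('i, 'j, 'l) row) \<Rightarrow> real" where
  "rmax N W us = Max (insert 0 ((\<lambda>w. lp_obj N w (us w)) ` vert W))"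

definition stops :: "('i::finite, 'j::finite, 'l::finite) grid \<Rightarrow> (real ^ 'j) set \<Rightarrow> bool" where
  "stops N W \<longleftrightarrow> (\<exists>us. lp_solutions N W us \<and> rmax N W us = 0)"

text \<open>One iteration that does not stop; the vertex attaining \<open>rmax\<close> need not be unique.\<close>

definition cut_step ::
    "('i::finite, 'j::finite, 'l::finite) grid \<Rightarrow> (real ^ 'j) set \<Rightarrow> (real ^ 'j) set \<Rightarrow> bool" where
  "cut_step N W W' \<longleftrightarrow>
     (\<exists>us. lp_solutions N W us \<and> rmax N W us \<noteq> 0 \<and>
       (\<exists>v\<in>vert W. lp_obj N v (us v) = rmax N W us \<and>
          W' = W \<inter> {w. us v \<bullet> (matB N *v w) \<ge> us v \<bullet> vecc N}))"

text \<open>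
  Whatever choices are made, no run started from \<open>W0\<close> goes on for ever, and a run can only end by
  meeting the stopping criterion.
\<close>

definition converges :: "('i::finite, 'j::finite, 'l::finite) grid \<Rightarrow> (real ^ 'j) set \<Rightarrow> bool" where
  "converges N W0 \<longleftrightarrow>
     (\<nexists>X. X 0 = W0 \<and> (\<forall>n::nat. cut_step N (X n) (X (Suc n)))) \<and>
     (\<forall>W. (cut_step N)\<^sup>*\<^sup>* W0 W \<longrightarrow> stops N W \<or> (\<exists>W'. cut_step N W W'))"

definition outputs ::
    "('i::finite, 'j::finite, 'l::finite) grid \<Rightarrow> (real ^ 'j) set \<Rightarrow> (real ^ 'j) set \<Rightarrow> bool" where
  "outputs N W0 W \<longleftrightarrow> (cut_step N)\<^sup>*\<^sup>* W0 W \<and> stops N W"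

definition orthant :: "(real ^ 'j) set" where
  "orthant = {w. \<forall>k. 0 \<le> w $ k}"

end

theory Submission
  imports Defs
begin

text \<open>
  By Farkas' lemma, \<open>w\<close> is absorbable iff every \<open>u\<close> in the dual polytope has a nonpositive objective
  at \<open>w\<close>; hence every cut is valid for the absorbable region.  A vertex of the dual polytope that
  generated a cut has a nonpositive objective on everything that remains, whereas the vertex used
  by a later cut has a positive objective at some remaining point, so no vertex is used twice.
  At termination all vertices of the current set are absorbable; if that set is bounded, it is the
  convex hull of its vertices and therefore lies in the (convex) absorbable region.
\<close>

section \<open>Farkas' lemma with normalised multipliers\<close>

text \<open>Weak duality gives one direction; for the other, \<open>b\<close> is separated from the
  cone of feasible right-hand sides. The cube bounds only normalise the nonpositive multipliers,
  since the sign of \<open>u \<bullet> b\<close> is invariant under positive scaling.\<close>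

lemma farkas_cube:
  fixes A :: "real ^ 'n::finite ^ 'm::finite"
  shows "(\<exists>d. \<forall>r. (A *v d) $ r \<le> b $ r) \<longleftrightarrow>
    (\<forall>u. transpose A *v u = 0 \<and> (\<forall>r. - 1 \<le> u $ r \<and> u $ r \<le> 0) \<longrightarrow> u \<bullet> b \<le> 0)"
proof
  assume "\<exists>d. \<forall>r. (A *v d) $ r \<le> b $ r"
  then obtain d where d: "\<And>r. (A *v d) $ r \<le> b $ r" by blast
  show "\<forall>u. transpose A *v u = 0 \<and> (\<forall>r. - 1 \<le> u $ r \<and> u $ r \<le> 0) \<longrightarrow> u \<bullet> b \<le> 0"
  proof (intro allI impI)
    fix u :: "real ^ 'm"
    assume u: "transpose A *v u = 0 \<and> (\<forall>r. - 1 \<le> u $ r \<and> u $ r \<le> 0)"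
    have "u \<bullet> b \<le> u \<bullet> (A *v d)"
      unfolding inner_vec_def using u d by (auto intro!: sum_mono mult_left_mono_neg)
    also have "\<dots> = 0"
      using u by (simp flip: dot_lmul_matrix)
    finally show "u \<bullet> b \<le> 0" .
  qed
next
  assume dual: "\<forall>u. transpose A *v u = 0 \<and> (\<forall>r. - 1 \<le> u $ r \<and> u $ r \<le> 0) \<longrightarrow> u \<bullet> b \<le> 0"
  \<comment> \<open>Generators of the cone of feasible right-hand sides: columns of \<open>A\<close>
    with both signs, and unit vectors for slack. There are finitely many, so the hull is polyhedral
    and hence closed, as separation requires.\<close>
  define S where "S = range (\<lambda>k. A *v axis k 1) \<union> range (\<lambda>k. - (A *v axis k 1)) \<union>
    range (\<lambda>r. axis r 1 :: real ^ 'm)"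
  define T where "T = {x. \<exists>d. \<forall>r. (A *v d) $ r \<le> x $ r}"
  have "S \<subseteq> T"
  proof -
    have image: "A *v d \<in> T" for d
      unfolding T_def by blast
    have "- (A *v axis k 1) \<in> T" for k
      using image[of "- axis k 1"] by (simp add: linear_neg)
    moreover have "axis r 1 \<in> T" for r
      unfolding T_def by (auto simp: axis_def intro!: exI[of _ 0])
    ultimately show ?thesis
      unfolding S_def using image by blast
  qed
  moreover have "convex_cone T"
    unfolding convex_cone_iff
  proof (intro conjI ballI allI impI)
    show "0 \<in> T"
      unfolding T_def by (auto intro!: exI[of _ 0])
  next
    fix x y assume "x \<in> T" "y \<in> T"
    then obtain d e where "\<And>r. (A *v d) $ r \<le> x $ r" "\<And>r. (A *v e) $ r \<le> y $ r"
      unfolding T_def by blast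
    then show "x + y \<in> T"
      unfolding T_def by (auto simp: matrix_vector_right_distrib add_mono intro!: exI[of _ "d + e"])
  next
    fix x and c :: real assume "x \<in> T" "0 \<le> c"
    then obtain d where "\<And>r. (A *v d) $ r \<le> x $ r"
      unfolding T_def by blast
    then show "c *\<^sub>R x \<in> T"
      unfolding T_def using \<open>0 \<le> c\<close>
      by (auto simp: matrix_vector_mult_scaleR mult_left_mono intro!: exI[of _ "c *\<^sub>R d"])
  qed
  ultimately have hull: "convex_cone hull S \<subseteq> T"
    by (rule hull_minimal)
  have "b \<in> convex_cone hull S"
  proof (rule ccontr)
    assume "b \<notin> convex_cone hull S"
    moreover have "polyhedron (convex_cone hull S)"
      unfolding S_def by (rule polyhedron_convex_cone_hull) simp
    ultimately obtain a \<beta> where ab: "a \<bullet> b < \<beta>" "\<And>x. x \<in> convex_cone hull S \<Longrightarrow> \<beta> < a \<bullet> x"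
      using separating_hyperplane_closed_point polyhedron_imp_closed polyhedron_imp_convex by metis
    have "\<beta> < 0"
      using ab(2)[OF convex_cone_hull_contains_0] by simp
    have nonneg: "0 \<le> a \<bullet> x" if "x \<in> S" for x
    proof (rule ccontr)
      assume neg: "\<not> 0 \<le> a \<bullet> x"
      \<comment> \<open>This multiple of \<open>x\<close> has inner product exactly \<beta> with
        \<open>a\<close>, which strict separation forbids in the cone.\<close>
      have "(\<beta> / (a \<bullet> x)) *\<^sub>R x \<in> convex_cone hull S"
        using \<open>x \<in> S\<close> neg \<open>\<beta> < 0\<close>
        by (intro convex_cone_hull_mul hull_inc) (auto simp: divide_nonpos_neg)
      from ab(2)[OF this] neg show False
        by simp
    qed
    have "(transpose A *v a) $ k = 0" for k
    proof -
      have "a \<bullet> (A *v axis k 1) = (transpose A *v a) $ k"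
        by (simp add: inner_axis flip: dot_lmul_matrix)
      moreover have "0 \<le> a \<bullet> (A *v axis k 1)" "0 \<le> a \<bullet> (- (A *v axis k 1))"
        by (rule nonneg, simp add: S_def)+
      ultimately show ?thesis by simp
    qed
    then have ker: "transpose A *v a = 0"
      by (simp add: vec_eq_iff)
    have pos: "0 \<le> a $ r" for r
      using nonneg[of "axis r 1"] by (simp add: S_def inner_axis)
    have "a \<noteq> 0"
      using ab \<open>\<beta> < 0\<close> by auto
    \<comment> \<open>The sign change makes the components nonpositive; dividing by the norm, which
      bounds every component, puts them into the cube.\<close>
    define u where "u = (- 1 / norm a) *\<^sub>R a"
    have "transpose A *v u = 0"
      unfolding u_def matrix_vector_mult_scaleR ker by simp
    moreover have "- 1 \<le> u $ r \<and> u $ r \<le> 0" for r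
      using pos[of r] component_le_norm_cart[of a r] \<open>a \<noteq> 0\<close> by (simp add: u_def field_simps)
    ultimately have "u \<bullet> b \<le> 0"
      using dual by blast
    moreover have "a \<bullet> b < 0"
      using ab(1) \<open>\<beta> < 0\<close> by linarith
    then have "0 < u \<bullet> b"
      using \<open>a \<noteq> 0\<close> by (simp add: u_def divide_neg_pos)
    ultimately show False by simp
  qed
  with hull show "\<exists>d. \<forall>r. (A *v d) $ r \<le> b $ r"
    unfolding T_def by blast
qed

section \<open>Linear programs over the dual polytope\<close>

text \<open>The maximisers form a compact convex face, and an extreme point of a face is an extreme
  point of the whole set.\<close>

lemma compact_linear_max_at_vertex:
  fixes S :: "'a::euclidean_space set"
  assumes "compact S" "convex S" "S \<noteq> {}"
  shows "\<exists>x\<in>vert S. \<forall>y\<in>S. y \<bullet> c \<le> x \<bullet> c"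
proof -
  have "continuous_on S (\<lambda>y. y \<bullet> c)"
    by (intro continuous_intros)
  from continuous_attains_sup[OF assms(1,3) this]
  obtain m where m: "m \<in> S" "\<And>y. y \<in> S \<Longrightarrow> y \<bullet> c \<le> m \<bullet> c"
    by blast
  define F where "F = S \<inter> {y. c \<bullet> y = m \<bullet> c}"
  have F: "F face_of S"
    unfolding F_def using assms m
    by (intro face_of_Int_supporting_hyperplane_le) (auto simp: inner_commute)
  have "m \<in> F"
    using m by (simp add: F_def inner_commute)
  moreover have "compact F" "convex F"
    using F assms face_of_imp_compact face_of_imp_convex by blast+
  ultimately obtain x where "x extreme_point_of F"
    using extreme_point_exists_convex by (metis empty_iff)
  then have "x extreme_point_of S" "x \<in> F"
    using extreme_point_of_face[OF F] by auto
  then show ?thesis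
    using m by (auto simp: vert_def F_def inner_commute intro!: bexI[of _ x])
qed

lemma polytope_dualU: "polytope (dualU N)"
proof -
  have "dualU N = (\<Inter>k. {u. (matA N *v axis k 1) \<bullet> u = 0}) \<inter> cbox (- 1) 0"
    by (auto simp: dualU_def vec_eq_iff mem_box_cart inner_axis inner_commute[of "_ *v _"]
        simp flip: dot_lmul_matrix)
  moreover have "polyhedron (\<Inter>k. {u. (matA N *v axis k 1) \<bullet> u = 0})"
    by (intro polyhedron_Inter) (auto simp: polyhedron_hyperplane)
  ultimately show ?thesis
    by (metis polyhedron_Int_polytope polytope_interval)
qed

lemma zero_in_dualU: "0 \<in> dualU N"
  by (simp add: dualU_def)

lemma vert_subset: "vert S \<subseteq> S"
  by (auto simp: vert_def extreme_point_of_def)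

lemma finite_vert: "polyhedron S \<Longrightarrow> finite (vert S)"
  for S :: "'a::euclidean_space set"
  unfolding vert_def by (rule finite_polyhedron_extreme_points)

text \<open>Ensures that no iteration gets stuck for want of an optimal vertex of the dual
  polytope.\<close>

lemma lp_solutions_exist: "\<exists>us. lp_solutions N W us"
proof -
  have "\<exists>x\<in>vert (dualU N). \<forall>u\<in>dualU N. lp_obj N w u \<le> lp_obj N w x" for w
    unfolding lp_obj_def using zero_in_dualU[of N]
    by (intro compact_linear_max_at_vertex polytope_imp_compact polytope_imp_convex polytope_dualU)
      blast
  then show ?thesis
    unfolding lp_solutions_def by metis
qed

section \<open>Dual description of the absorbable region\<close>

lemma lp_obj_nonpos_iff:
  "lp_obj N w u \<le> 0 \<longleftrightarrow> u \<bullet> vecc N \<le> u \<bullet> (matB N *v w)"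
  by (simp add: lp_obj_def inner_diff_right)

text \<open>Moving \<open>matB N\<close> to the other side of the inner product gives the cut an
  explicit normal vector, so that the facts on half-spaces apply.\<close>

lemma cut_halfspace:
  "{w. u \<bullet> (matB N *v w) \<ge> u \<bullet> vecc N} = {w. (u v* matB N) \<bullet> w \<ge> u \<bullet> vecc N}"
  by (simp flip: dot_lmul_matrix)

lemma absorbable_iff: "w \<in> absorbable N \<longleftrightarrow> (\<forall>u\<in>dualU N. lp_obj N w u \<le> 0)"
proof -
  have "w \<in> absorbable N \<longleftrightarrow> (\<exists>d. \<forall>r. (matA N *v d) $ r \<le> (vecc N - matB N *v w) $ r)"
    by (auto simp: absorbable_def psi_compact algebra_simps)
  then show ?thesis
    unfolding farkas_cube by (simp only: dualU_def lp_obj_def Ball_def mem_Collect_eq)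
qed

lemma convex_absorbable: "convex (absorbable N)"
proof -
  have "absorbable N = (\<Inter>u\<in>dualU N. {w. u \<bullet> (matB N *v w) \<ge> u \<bullet> vecc N})"
    by (auto simp: absorbable_iff lp_obj_nonpos_iff)
  then show ?thesis
    by (simp add: cut_halfspace convex_INT convex_halfspace_ge)
qed

section \<open>Cutting steps and termination\<close>

lemma cut_stepE:
  assumes "cut_step N W W'"
  obtains u v where "u \<in> vert (dualU N)" "v \<in> W" "0 < lp_obj N v u"
    "W' = W \<inter> {w. u \<bullet> (matB N *v w) \<ge> u \<bullet> vecc N}"
proof -
  from assms obtain us v where *: "lp_solutions N W us" "rmax N W us \<noteq> 0" "v \<in> vert W"
      "lp_obj N v (us v) = rmax N W us"
      "W' = W \<inter> {w. us v \<bullet> (matB N *v w) \<ge> us v \<bullet> vecc N}"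
    unfolding cut_step_def by blast
  \<comment> \<open>Comparison with the feasible point 0 makes the optimal value nonnegative; as it
    equals the nonzero \<open>rmax\<close>, it is positive.\<close>
  have "lp_obj N v 0 \<le> lp_obj N v (us v)"
    using *(1,3) zero_in_dualU unfolding lp_solutions_def by blast
  then have "0 < lp_obj N v (us v)"
    using * by (simp add: lp_obj_def)
  moreover have "us v \<in> vert (dualU N)" "v \<in> W"
    using *(1,3) vert_subset unfolding lp_solutions_def by blast+
  ultimately show thesis
    using that *(5) by blast
qed

lemma cut_steps_invariant:
  assumes "(cut_step N)\<^sup>*\<^sup>* W0 W" "absorbable N \<subseteq> W0"
  shows "absorbable N \<subseteq> W"
  using assms(1)
proof induction
  case (step W W')
  from step.hyps(2) show ?case
  proof (cases rule: cut_stepE)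
    case (1 u v)
    then show ?thesis
      using step.IH vert_subset absorbable_iff lp_obj_nonpos_iff by blast
  qed
qed (fact assms(2))

text \<open>Polyhedrality keeps the vertex set finite, so that the \<open>Max\<close> in
  \<open>rmax\<close> is meaningful in every iteration.\<close>

lemma cut_steps_polyhedron:
  assumes "(cut_step N)\<^sup>*\<^sup>* W0 W" "polyhedron W0"
  shows "polyhedron W"
  using assms(1)
proof induction
  case (step W W')
  from step.hyps(2) show ?case
  proof (cases rule: cut_stepE)
    case (1 u v)
    then show ?thesis
      using step.IH unfolding cut_halfspace by (simp add: polyhedron_halfspace_ge)
  qed
qed (fact assms(2))

lemma cut_steps_subset:
  assumes "(cut_step N)\<^sup>*\<^sup>* W0 W"
  shows "W \<subseteq> W0"
  using assms by induction (auto elim!: cut_stepE)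

lemma no_infinite_run: "\<not> (\<forall>n::nat. cut_step N (X n) (X (Suc n)))"
proof
  assume run: "\<forall>n. cut_step N (X n) (X (Suc n))"
  have "\<exists>u v. u \<in> vert (dualU N) \<and> v \<in> X n \<and> 0 < lp_obj N v u \<and>
      X (Suc n) = X n \<inter> {w. u \<bullet> (matB N *v w) \<ge> u \<bullet> vecc N}" for n
    using run[rule_format, of n] by (elim cut_stepE) blast
  then obtain u v where uv: "\<And>n. u n \<in> vert (dualU N)" "\<And>n. v n \<in> X n"
      "\<And>n. 0 < lp_obj N (v n) (u n)"
      "\<And>n. X (Suc n) = X n \<inter> {w. u n \<bullet> (matB N *v w) \<ge> u n \<bullet> vecc N}"
    by metis
  \<comment> \<open>The point \<open>v n\<close> survives the earlier cut by \<open>u m\<close> but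
    violates the cut by \<open>u n\<close>.\<close>
  have "u m \<noteq> u n" if "m < n" for m n
  proof -
    have "X n \<subseteq> X (Suc m)"
    proof (rule lift_Suc_antimono_le[of X])
      show "X (Suc k) \<subseteq> X k" for k
        by (auto simp: uv(4))
      show "Suc m \<le> n"
        using that by simp
    qed
    then have "v n \<in> X (Suc m)"
      using uv(2) by blast
    then have "lp_obj N (v n) (u m) \<le> 0"
      by (simp add: uv(4) lp_obj_nonpos_iff)
    then show ?thesis
      using uv(3)[of n] by auto
  qed
  then have "inj u"
    by (metis injI linorder_neqE_nat)
  moreover have "finite (range u)"
    using uv(1) finite_vert[OF polytope_imp_polyhedron[OF polytope_dualU]]
    by (meson finite_subset image_subsetI)
  ultimately show False
    using finite_imageD infinite_UNIV_nat by blast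
qed

lemma stops_or_cuts:
  assumes "polyhedron W"
  shows "stops N W \<or> (\<exists>W'. cut_step N W W')"
proof -
  obtain us where us: "lp_solutions N W us"
    using lp_solutions_exist by blast
  show ?thesis
  proof (cases "rmax N W us = 0")
    case True
    with us show ?thesis
      unfolding stops_def by blast
  next
    case False
    \<comment> \<open>The maximum is attained; when nonzero it is not the inserted default 0, so
      some vertex of \<open>W\<close> attains it and yields a cut.\<close>
    have "rmax N W us \<in> insert 0 ((\<lambda>w. lp_obj N w (us w)) ` vert W)"
      unfolding rmax_def using finite_vert[OF assms] by (intro Max_in) auto
    with False us show ?thesis
      unfolding cut_step_def by (metis (no_types, lifting) imageE insertE)
  qed
qed

lemma converges_polyhedron: "polyhedron W0 \<Longrightarrow> converges N W0"
  unfolding converges_def using no_infinite_run stops_or_cuts cut_steps_polyhedron by blast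

section \<open>Correctness of the output\<close>

lemma stops_imp_vert_absorbable:
  assumes "polyhedron W" "stops N W"
  shows "vert W \<subseteq> absorbable N"
proof
  fix w assume w: "w \<in> vert W"
  obtain us where us: "lp_solutions N W us" "rmax N W us = 0"
    using assms(2) unfolding stops_def by blast
  have "lp_obj N w (us w) \<le> rmax N W us"
    unfolding rmax_def using finite_vert[OF assms(1)] w by (intro Max_ge) auto
  then show "w \<in> absorbable N"
    using us w by (force simp: absorbable_iff lp_solutions_def)
qed

text \<open>Boundedness is what lets Minkowski's theorem recover \<open>W\<close> from its vertices;
  the stopping test does not see recession directions.\<close>

lemma outputs_bounded:
  assumes "outputs N W0 W" "polyhedron W0" "absorbable N \<subseteq> W0" "bounded W"
  shows "W = absorbable N"
proof
  have W: "polyhedron W" "stops N W"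
    using assms cut_steps_polyhedron by (auto simp: outputs_def)
  have "W = convex hull (vert W)"
    unfolding vert_def using W(1) assms(4)
    by (intro Krein_Milman_Minkowski)
      (auto simp: compact_eq_bounded_closed polyhedron_imp_closed polyhedron_imp_convex)
  also have "\<dots> \<subseteq> absorbable N"
    using stops_imp_vert_absorbable[OF W] convex_absorbable by (rule hull_minimal)
  finally show "W \<subseteq> absorbable N" .
  show "absorbable N \<subseteq> W"
    using assms(1,3) cut_steps_invariant unfolding outputs_def by blast
qed

lemma polyhedron_orthant: "polyhedron (orthant :: (real ^ 'j::finite) set)"
proof -
  have "(orthant :: (real ^ 'j) set) = (\<Inter>k. {w. axis k 1 \<bullet> w \<ge> 0})"
    by (auto simp: orthant_def inner_axis')
  also have "polyhedron \<dots>"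
    by (intro polyhedron_Inter) (auto simp: polyhedron_halfspace_ge)
  finally show ?thesis .
qed

text \<open>The power balance bounds the total output by the largest total demand.\<close>

lemma bounded_absorbable_orthant:
  assumes "absorbable N \<subseteq> orthant"
  shows "bounded (absorbable N)"
proof (rule boundedI)
  fix w assume w: "w \<in> absorbable N"
  then obtain d where d: "d \<in> psi N w"
    by (auto simp: absorbable_def)
  have "norm w \<le> (\<Sum>k\<in>UNIV. \<bar>w $ k\<bar>)"
    by (rule norm_le_l1_cart)
  also have "\<dots> = (\<Sum>k\<in>UNIV. w $ k)"
    using w assms by (intro sum.cong) (auto simp: orthant_def)
  also have "\<dots> = (\<Sum>k\<in>UNIV. d $ k) + (\<Sum>k\<in>UNIV. dfix N k)"
    using d by (simp add: psi_def)
  also have "\<dots> \<le> (\<Sum>k\<in>UNIV. dhi N k) + (\<Sum>k\<in>UNIV. dfix N k)"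
    using d by (auto simp: psi_def intro!: sum_mono)
  finally show "norm w \<le> (\<Sum>k\<in>UNIV. dhi N k) + (\<Sum>k\<in>UNIV. dfix N k)" .
qed

text \<open>The stopping test inspects vertices only, so an unbounded set may pass it: if 0 is
  absorbable, a run from \<open>orthant\<close> stops at once with output \<open>orthant\<close>.
  Hence equality from \<open>orthant\<close> is tied to boundedness of the output, while a polytope
  containing the region, a truly large enough start, always gives equality. The inclusion in
  \<open>orthant\<close> is assumed because absorbable points with a negative component are lost
  from the start.\<close>

theorem mainTheorem4:
  fixes N :: "('i::finite, 'j::finite, 'l::finite) grid"
  assumes "\<And>k. dlo N k \<le> dhi N k"
  shows "finite (vert (dualU N)) \<and>
    converges N orthant \<and>
    (absorbable N \<subseteq> orthant \<longrightarrow>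
       (\<forall>W. outputs N orthant W \<longrightarrow> (W = absorbable N \<longleftrightarrow> bounded W))) \<and>
    (\<forall>W0. polytope W0 \<and> absorbable N \<subseteq> W0 \<longrightarrow>
       converges N W0 \<and> (\<forall>W. outputs N W0 W \<longrightarrow> W = absorbable N))"
proof (intro conjI impI allI)
  show "finite (vert (dualU N))"
    by (rule finite_vert[OF polytope_imp_polyhedron[OF polytope_dualU]])
  show "converges N orthant"
    by (rule converges_polyhedron[OF polyhedron_orthant])
next
  fix W assume "absorbable N \<subseteq> orthant" "outputs N orthant W"
  then show "W = absorbable N \<longleftrightarrow> bounded W"
    using outputs_bounded[OF _ polyhedron_orthant] bounded_absorbable_orthant by blast
next
  fix W0 assume "polytope W0 \<and> absorbable N \<subseteq> W0"
  then show "converges N W0"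
    using converges_polyhedron polytope_imp_polyhedron by blast
next
  fix W0 W assume W0: "polytope W0 \<and> absorbable N \<subseteq> W0" and W: "outputs N W0 W"
  \<comment> \<open>Cuts only shrink the initial polytope.\<close>
  then have "bounded W"
    using cut_steps_subset polytope_imp_bounded bounded_subset unfolding outputs_def by metis
  with W0 W show "W = absorbable N"
    using outputs_bounded polytope_imp_polyhedron by blast
qed

end
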